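(* Let $n>1$, let $G=C_n$ be the simply connected compact symplectic group of rank $n$ (denoted $Sp(n)$), let $m$ be a positive integer and $p$ a prime. Write $m=p^i m'$ with $p\nmid m'$. (1) If $p=2$, then $N(C_n,m,2)$ is the number of tuples $(b_1,\dots,b_n)\in\mathbb{Z}^n$ such that $p^i>b_1>\dots>b_n>0$; explicitly, $$N(C_n,m,2)=\binom{2^i-1}{n}.$$ (2) If $p>2$, then $N(C_n,m,p)$ is the number of tuples $(b_1,\dots,b_n)\in\mathbb{Z}^n$ such that $p^i>b_1>\dots>b_n>0$ and $2\mid b_j$ for all $j=1,\dots,n$; explicitly, $$N(C_n,m,p)=\binom{\frac{p^i-1}{2}}{n}.$$
   Context: Let $G$ be a simply connected simple compact Lie group with maximal torus $T$ and weight lattice $\Pi^*=\mathrm{Hom}(T,S^1)$. $\langle\cdot,\cdot\rangle$ is the unique Weyl-invariant inner product on $\Pi^*$ (extended to $\Pi^*\otimes\mathbb{R}$) with $\langle u,u\rangle=2$ for all long roots $u$ (in the simply laced case all roots are long). The fundamental Weyl chamber $V\subset\Pi^*\otimes\mathbb{R}$ is the set of points having non-negative inner product with all positive roots; $\theta$ is the highest root. The level $m$ fundamental alcove is $A=\{x\in V:\langle\theta,x\rangle\le m\}$. A level $m$ regular weight is an element of $\Pi^*$ in the interior of $A$. $N(G,m,p)$ denotes the number of level $m$ regular weights $a$ such that for every weight $w\in\Pi^*$ the denominator (in lowest terms) of the rational number $\langle w,a\rangle/m$ is a power $p^k$, $k\ge0$, of $p$. *)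

theory Defs
  imports "HOL-Analysis.Analysis" "HOL-Computational_Algebra.Primes"
begin

section \<open>Compact matrix groups with a torus\<close>

text \<open>
  A compact matrix group is a set \<open>G\<close> of complex matrices.  A torus \<open>T\<close> of \<open>G\<close> is given by its
  exponential map \<open>D\<close>, so \<open>T = range D\<close>, where the domain of \<open>D\<close> is the Lie algebra of \<open>T\<close>.
  It is scaled such that a weight \<open>f : T \<rightarrow> S\<^sup>1\<close> has the form
  \<open>f (D x) = exp (2 \<pi> \<i> \<lambda>(x))\<close> with a linear functional \<open>\<lambda>\<close>.

  Weights are identified with these functionals, and the latter with vectors \<open>w\<close> via
  \<open>\<lambda>(x) = w \<bullet> x\<close>.  Thus the ambient Euclidean space is \<open>\<Pi>\<^sup>* \<otimes> \<real>\<close>; the dot product is used only as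
  the pairing with the Lie algebra of \<open>T\<close>, it is not the normalised inner product on weights.
\<close>

definition weight_lattice :: "('v::euclidean_space \<Rightarrow> complex^'k^'k) \<Rightarrow> 'v set" where
  "weight_lattice D = {w. \<exists>f::complex^'k^'k \<Rightarrow> complex.
      continuous_on (range D) f \<and> f ` range D \<subseteq> sphere 0 1 \<and>
      (\<forall>s\<in>range D. \<forall>t\<in>range D. f (s ** t) = f s * f t) \<and>
      (\<forall>x. f (D x) = cis (2 * pi * (w \<bullet> x)))}"

definition complexification :: "(complex^'k^'k) set \<Rightarrow> (complex^'k^'k) set" where
  "complexification L = {X. \<exists>A\<in>L. \<exists>B\<in>L. X = (\<chi> r c. A $ r $ c + \<i> * B $ r $ c)}"

text \<open>The roots are the nonzero weights of the adjoint action of the torus on the complexification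
  of the Lie algebra \<open>L\<close>.\<close>

definition roots ::
    "(complex^'k^'k) set \<Rightarrow> ('v::euclidean_space \<Rightarrow> complex^'k^'k) \<Rightarrow> 'v set" where
  "roots L D = {\<alpha>. \<alpha> \<noteq> 0 \<and> (\<exists>X\<in>complexification L. X \<noteq> 0 \<and>
      (\<forall>x. D x ** X ** matrix_inv (D x) = (\<chi> r c. cis (2 * pi * (\<alpha> \<bullet> x)) * X $ r $ c)))}"

text \<open>The linear map \<open>s\<close> below is the action of an element of the normaliser of the torus on the
  Lie algebra of the torus, and \<open>adjoint s\<close> is its transpose, acting on \<open>\<Pi>\<^sup>* \<otimes> \<real>\<close>.\<close>

definition weyl_group ::
    "(complex^'k^'k) set \<Rightarrow> ('v::euclidean_space \<Rightarrow> complex^'k^'k) \<Rightarrow> ('v \<Rightarrow> 'v) set" where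
  "weyl_group G D = {adjoint s |s. linear s \<and>
      (\<exists>g\<in>G. \<forall>x. g ** D x ** matrix_inv g = D (s x))}"


section \<open>Alcoves and regular weights\<close>

definition is_inner_product :: "('v::real_vector \<Rightarrow> 'v \<Rightarrow> real) \<Rightarrow> bool" where
  "is_inner_product B \<longleftrightarrow>
     bilinear B \<and> (\<forall>x y. B x y = B y x) \<and> (\<forall>x. x \<noteq> 0 \<longrightarrow> B x x > 0)"

definition long_roots :: "('v \<Rightarrow> 'v \<Rightarrow> real) \<Rightarrow> 'v set \<Rightarrow> 'v set" where
  "long_roots B R = {u\<in>R. \<forall>v\<in>R. B v v \<le> B u u}"

definition basic_inner ::
    "('v::euclidean_space) set \<Rightarrow> ('v \<Rightarrow> 'v) set \<Rightarrow> 'v \<Rightarrow> 'v \<Rightarrow> real" where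
  "basic_inner R W = (THE B. is_inner_product B \<and>
      (\<forall>s\<in>W. \<forall>x y. B (s x) (s y) = B x y) \<and> (\<forall>u\<in>long_roots B R. B u u = 2))"

definition positive_system :: "('v::euclidean_space) set \<Rightarrow> 'v set \<Rightarrow> bool" where
  "positive_system R P \<longleftrightarrow>
     (\<exists>h. (\<forall>\<alpha>\<in>R. \<alpha> \<bullet> h \<noteq> 0) \<and> P = {\<alpha>\<in>R. \<alpha> \<bullet> h > 0})"

text \<open>The maximum of \<open>R\<close> in the root order: \<open>\<alpha> \<le> \<theta>\<close> iff \<open>\<theta> - \<alpha>\<close> is a sum of positive roots.\<close>

definition highest_root :: "('v::euclidean_space) set \<Rightarrow> 'v set \<Rightarrow> 'v" where
  "highest_root R P = (THE \<theta>. \<theta> \<in> R \<and>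
      (\<forall>\<alpha>\<in>R. \<exists>c::'v \<Rightarrow> nat. \<theta> - \<alpha> = (\<Sum>\<beta>\<in>P. real (c \<beta>) *\<^sub>R \<beta>)))"

definition weyl_chamber :: "('v \<Rightarrow> 'v \<Rightarrow> real) \<Rightarrow> 'v set \<Rightarrow> 'v set" where
  "weyl_chamber B P = {x. \<forall>\<alpha>\<in>P. B \<alpha> x \<ge> 0}"

definition alcove :: "('v \<Rightarrow> 'v \<Rightarrow> real) \<Rightarrow> 'v set \<Rightarrow> 'v \<Rightarrow> nat \<Rightarrow> 'v set" where
  "alcove B P \<theta> m = {x\<in>weyl_chamber B P. B \<theta> x \<le> real m}"

definition regular_weights ::
    "('v::euclidean_space) set \<Rightarrow> 'v set \<Rightarrow> ('v \<Rightarrow> 'v) set \<Rightarrow> 'v set \<Rightarrow> nat \<Rightarrow> 'v set" where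
  "regular_weights \<Lambda> R W P m =
     \<Lambda> \<inter> interior (alcove (basic_inner R W) P (highest_root R P) m)"

definition denom_power :: "nat \<Rightarrow> real \<Rightarrow> bool" where
  "denom_power p x \<longleftrightarrow>
     (\<exists>q::rat. x = of_rat q \<and> (\<exists>k::nat. snd (quotient_of q) = int p ^ k))"

text \<open>The number \<open>N(G,m,p)\<close>, for a compact group \<open>G\<close> with Lie algebra \<open>L\<close>, maximal torus with
  exponential map \<open>D\<close>, and positive roots \<open>P\<close>.\<close>

definition num_regular_weights ::
    "(complex^'k^'k) set \<Rightarrow> (complex^'k^'k) set \<Rightarrow> ('v::euclidean_space \<Rightarrow> complex^'k^'k) \<Rightarrow>
     'v set \<Rightarrow> nat \<Rightarrow> nat \<Rightarrow> nat" where
  "num_regular_weights G L D P m p =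
     card {a \<in> regular_weights (weight_lattice D) (roots L D) (weyl_group G D) P m.
       \<forall>w\<in>weight_lattice D.
         denom_power p (basic_inner (roots L D) (weyl_group G D) w a / real m)}"


section \<open>The compact symplectic group\<close>

definition conj_transpose :: "complex^'k^'k \<Rightarrow> complex^'k^'k" where
  "conj_transpose A = (\<chi> r c. cnj (A $ c $ r))"

definition symp_J :: "complex^('n::finite + 'n)^('n + 'n)" where
  "symp_J = (\<chi> r c. case (r, c) of
      (Inl i, Inr j) \<Rightarrow> if i = j then 1 else 0
    | (Inr i, Inl j) \<Rightarrow> if i = j then -1 else 0
    | _ \<Rightarrow> 0)"

text \<open>\<open>Sp(n)\<close> as the group of unitary complex symplectic \<open>2n \<times> 2n\<close> matrices, \<open>n = CARD('n)\<close>,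
  and its Lie algebra.\<close>

definition Sp :: "(complex^('n::finite + 'n)^('n + 'n)) set" where
  "Sp = {A. conj_transpose A ** A = mat 1 \<and> transpose A ** symp_J ** A = symp_J}"

definition sp_lie :: "(complex^('n::finite + 'n)^('n + 'n)) set" where
  "sp_lie = {X. conj_transpose X + X = 0 \<and> transpose X ** symp_J + symp_J ** X = 0}"

definition sp_torus :: "real^'n \<Rightarrow> complex^('n::finite + 'n)^('n + 'n)" where
  "sp_torus x = (\<chi> r c. if r = c
     then (case r of Inl j \<Rightarrow> cis (2 * pi * x $ j) | Inr j \<Rightarrow> cis (- (2 * pi * x $ j)))
     else 0)"

definition sp_roots :: "(real^'n::finite) set" where
  "sp_roots = roots sp_lie sp_torus"

text \<open>\<open>N(C\<^sub>n,m,p)\<close>, \<open>n = CARD('n)\<close>, computed with the positive roots \<open>P\<close>.\<close>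

definition N_C :: "(real^'n::finite) set \<Rightarrow> nat \<Rightarrow> nat \<Rightarrow> nat" where
  "N_C P m p = num_regular_weights Sp sp_lie sp_torus P m p"

text \<open>\<open>range sp_torus\<close> is its own centraliser in \<open>Sp\<close>, hence a maximal torus.\<close>

lemma sp_torus_nth:
  "sp_torus x $ r $ c = (if r = c
     then (case r of Inl j \<Rightarrow> cis (2 * pi * x $ j) | Inr j \<Rightarrow> cis (- (2 * pi * x $ j)))
     else 0)"
  by (simp add: sp_torus_def)

lemma diagonal_mult:
  fixes M N :: "complex^'k^'k"
  assumes "\<forall>r c. r \<noteq> c \<longrightarrow> N $ r $ c = 0"
  shows "(M ** N) $ r $ c = M $ r $ c * N $ c $ c" "(N ** M) $ r $ c = N $ r $ r * M $ r $ c"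
proof -
  have "(\<Sum>k\<in>UNIV. M $ r $ k * N $ k $ c) = (\<Sum>k\<in>UNIV. if k = c then M $ r $ c * N $ c $ c else 0)"
    by (rule sum.cong) (auto simp: assms)
  then show "(M ** N) $ r $ c = M $ r $ c * N $ c $ c"
    by (simp add: matrix_matrix_mult_def)
  have "(\<Sum>k\<in>UNIV. N $ r $ k * M $ k $ c) = (\<Sum>k\<in>UNIV. if k = r then N $ r $ r * M $ r $ c else 0)"
    by (rule sum.cong) (auto simp: assms)
  then show "(N ** M) $ r $ c = N $ r $ r * M $ r $ c"
    by (simp add: matrix_matrix_mult_def)
qed

lemma diagonal_in_Sp_iff:
  fixes A :: "complex^('n::finite + 'n)^('n + 'n)"
  assumes d: "\<forall>r c. r \<noteq> c \<longrightarrow> A $ r $ c = 0"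
  shows "A \<in> Sp \<longleftrightarrow> (\<forall>r. cnj (A $ r $ r) * A $ r $ r = 1) \<and>
    (\<forall>j. A $ Inl j $ Inl j * A $ Inr j $ Inr j = 1)"
proof -
  have t: "\<forall>r c. r \<noteq> c \<longrightarrow> transpose A $ r $ c = 0"
    using d by (simp add: transpose_def)
  have "conj_transpose A ** A = mat 1 \<longleftrightarrow> (\<forall>r. cnj (A $ r $ r) * A $ r $ r = 1)"
    by (auto simp: vec_eq_iff diagonal_mult[OF d] mat_def conj_transpose_def d)
  moreover have "transpose A ** symp_J ** A = symp_J \<longleftrightarrow>
      (\<forall>j. A $ Inl j $ Inl j * A $ Inr j $ Inr j = 1)"
  proof -
    have "(transpose A ** symp_J ** A) $ r $ c = A $ r $ r * symp_J $ r $ c * A $ c $ c" for r c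
      unfolding diagonal_mult(1)[OF d] diagonal_mult(2)[OF t] by (simp add: transpose_def)
    then show ?thesis
      by (auto simp: vec_eq_iff symp_J_def split_sum_all mult.commute)
  qed
  ultimately show ?thesis
    by (simp add: Sp_def)
qed

lemma centraliser_sp_torus:
  "{A \<in> Sp. \<forall>x. A ** sp_torus x = sp_torus x ** A} = range (sp_torus :: real^'n::finite \<Rightarrow> _)"
proof (rule set_eqI, rule iffI)
  fix A :: "complex^('n + 'n)^('n + 'n)"
  assume "A \<in> range sp_torus"
  then obtain x where A: "A = sp_torus x" by blast
  have d: "\<forall>r c. r \<noteq> c \<longrightarrow> sp_torus y $ r $ c = 0" for y :: "real^'n"
    by (simp add: sp_torus_nth)
  have "sp_torus x \<in> Sp"
    by (subst diagonal_in_Sp_iff) (auto simp: sp_torus_nth cis_mult cis_cnj split: sum.splits)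
  moreover have "sp_torus x ** sp_torus y = sp_torus y ** sp_torus x" for y
    by (simp add: vec_eq_iff diagonal_mult(1)[OF d] sp_torus_nth)
  ultimately show "A \<in> {A \<in> Sp. \<forall>x. A ** sp_torus x = sp_torus x ** A}"
    by (simp add: A)
next
  fix A :: "complex^('n + 'n)^('n + 'n)"
  assume "A \<in> {A \<in> Sp. \<forall>x. A ** sp_torus x = sp_torus x ** A}"
  then have A: "A \<in> Sp" and comm: "\<And>x. A ** sp_torus x = sp_torus x ** A" by auto
  have dt: "\<forall>r c. r \<noteq> c \<longrightarrow> sp_torus y $ r $ c = 0" for y :: "real^'n"
    by (simp add: sp_torus_nth)
  have d: "\<forall>r c. r \<noteq> c \<longrightarrow> A $ r $ c = 0"
  proof (intro allI impI)
    fix r c :: "'n + 'n"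
    assume that: "r \<noteq> c"
    define j where "j = (case r of Inl k \<Rightarrow> k | Inr k \<Rightarrow> k)"
    define x :: "real^'n" where "x = axis j (1/4)"
    have q: "cis (2 * pi * (1/4)) = \<i>" "cis (- (2 * pi * (1/4))) = - \<i>"
      using cis_pi_half cis_minus_pi_half by simp_all
    have "sp_torus x $ r $ r \<noteq> sp_torus x $ c $ c"
      using that q by (auto simp: sp_torus_nth x_def j_def axis_def complex_eq_iff split: sum.splits)
    moreover have "(A ** sp_torus x) $ r $ c = (sp_torus x ** A) $ r $ c"
      by (simp add: comm)
    then have "A $ r $ c * sp_torus x $ c $ c = sp_torus x $ r $ r * A $ r $ c"
      by (simp only: diagonal_mult[OF dt])
    ultimately show "A $ r $ c = 0" by (simp add: mult.commute)
  qed
  have u: "cnj (A $ r $ r) * A $ r $ r = 1" for r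
    using A diagonal_in_Sp_iff[OF d] by blast
  have s: "A $ Inl j $ Inl j * A $ Inr j $ Inr j = 1" for j
    using A diagonal_in_Sp_iff[OF d] by blast
  define x :: "real^'n" where "x = (\<chi> j. Arg (A $ Inl j $ Inl j) / (2 * pi))"
  have l: "cis (2 * pi * x $ j) = A $ Inl j $ Inl j" for j
  proof -
    have "norm (A $ Inl j $ Inl j) = 1"
      using u[of "Inl j"] by (metis complex_mod_cnj norm_mult norm_one norm_ge_zero
          power2_eq_square power2_eq_1_iff zero_le_one abs_norm_cancel real_sqrt_abs2 real_sqrt_one)
    then show ?thesis
      using rcis_cmod_Arg[of "A $ Inl j $ Inl j"] by (simp add: x_def rcis_def)
  qed
  have r: "cis (- (2 * pi * x $ j)) = A $ Inr j $ Inr j" for j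
    using s[of j] by (simp flip: cis_inverse add: l inverse_unique)
  have "A = sp_torus x"
    by (auto simp: vec_eq_iff sp_torus_nth d l r split: sum.splits)
  then show "A \<in> range sp_torus" by blast
qed

end

(* The roots of C_n are the differences of the vectors +-e_j.  Elements of the Weyl group act by
   isometries, and they include all sign changes and transpositions, so the basic inner product
   is half the dot product.  For a positive system given by h, the highest root is 2u with u the
   vector +-e_j on which h is maximal.  A regular weight is thus an integral vector whose
   coordinates, with signs and order prescribed by h, strictly decrease within the open interval
   (0, m).  The condition on denominators says that every coordinate is divisible by m' (p = 2)
   or 2m' (p > 2); dividing by m' gives the lists to be counted. *)
theory Submission
  imports Defs
begin

section \<open>Weights and roots of \<open>Sp(n)\<close>\<close>

text \<open>The vector \<open>eps r\<close> is the weight of the torus on the \<open>r\<close>-th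
  basis vector of the standard representation. Indexing by \<open>'n + 'n\<close> treats short and
  long roots alike: the long ones are the differences with \<open>c = flip r\<close>. Since
  \<open>basic_inner\<close> and \<open>highest_root\<close> are definite descriptions, existence
  and uniqueness are both needed. For the inner product, existence calls for invariance under every
  Weyl group element and uniqueness for enough explicit elements, but the group itself is never
  computed. The positive system is not moved to a standard one: the indices with
  \<open>eps r \<bullet> h > 0\<close> replace the standard coordinates. The bounds 0 and
  \<open>m\<close> come from the long positive roots and from the highest root, whose factor 2
  cancels against the half in the inner product. The same half turns the pairing of a unit weight
  with \<open>a\<close>, divided by \<open>m\<close>, into a coordinate over \<open>2 * m\<close>.
  The extra 2 is a harmless denominator for \<open>p = 2\<close>, but must divide the coordinate
  when \<open>p\<close> is odd.\<close>

definition eps :: "'n + 'n \<Rightarrow> real^'n::finite" where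
  "eps r = (case r of Inl j \<Rightarrow> axis j 1 | Inr j \<Rightarrow> - axis j 1)"

text \<open>The partner of an index under the symplectic form, which carries the opposite
  weight.\<close>

definition flip :: "'n + 'n \<Rightarrow> 'n + 'n" where
  "flip r = (case r of Inl j \<Rightarrow> Inr j | Inr j \<Rightarrow> Inl j)"

lemma flip_simps [simp]: "flip (Inl j) = Inr j" "flip (Inr j) = Inl j" "flip (flip r) = r"
  by (simp_all add: flip_def split: sum.split)

lemma flip_eq_flip_iff [simp]: "flip r = flip c \<longleftrightarrow> r = c"
  by (metis flip_simps(3))

lemma isl_flip [simp]: "isl (flip r) \<longleftrightarrow> \<not> isl r"
  by (cases r) simp_all

lemma flip_neq [simp]: "flip r \<noteq> r" "r \<noteq> flip r"
  by (cases r; simp)+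

lemma eps_simps [simp]: "eps (Inl j) = axis j 1" "eps (Inr j) = - axis j 1"
  by (simp_all add: eps_def)

lemma eps_flip [simp]: "eps (flip r) = - eps r"
  by (cases r) simp_all

lemma eps_inner: "eps r \<bullet> eps c = (if r = c then 1 else if r = flip c then - 1 else 0)"
  by (cases r; cases c) (auto simp: inner_axis_axis)

lemma norm_eps [simp]: "norm (eps r) = 1"
  by (simp add: norm_eq_sqrt_inner eps_inner)

lemma inj_eps: "inj eps"
  by (rule injI) (metis eps_inner one_neq_neg_one zero_neq_one)

lemma eps_inner_eq: "eps r \<bullet> x = (case r of Inl j \<Rightarrow> x $ j | Inr j \<Rightarrow> - (x $ j))"
  by (cases r) (simp_all add: inner_axis')

lemma sp_torus_eps: "sp_torus x $ r $ c = (if r = c then cis (2 * pi * (eps r \<bullet> x)) else 0)"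
  by (simp add: sp_torus_nth eps_inner_eq split: sum.split)

lemma sp_torus_diagonal: "\<forall>r c. r \<noteq> c \<longrightarrow> sp_torus x $ r $ c = 0"
  by (simp add: sp_torus_eps)

lemma sp_torus_0 [simp]: "sp_torus 0 = mat 1"
  by (auto simp: vec_eq_iff sp_torus_eps mat_def)

lemma sp_torus_add: "sp_torus (x + y) = sp_torus x ** sp_torus y"
  by (auto simp: vec_eq_iff diagonal_mult[OF sp_torus_diagonal] sp_torus_eps cis_mult
      inner_add_right ring_distribs)

lemma matrix_inv_eqI:
  fixes A :: "'a::semiring_1^'k^'k"
  assumes "A ** B = mat 1" "B ** A = mat 1"
  shows "matrix_inv A = B"
proof -
  have "A ** matrix_inv A = mat 1"
    using someI[of "\<lambda>B. A ** B = mat 1 \<and> B ** A = mat 1" B] assms by (simp add: matrix_inv_def)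
  then show ?thesis
    using assms by (metis matrix_mul_assoc matrix_mul_lid matrix_mul_rid)
qed

lemma matrix_inv_sp_torus: "matrix_inv (sp_torus x) = sp_torus (- x)"
  by (rule matrix_inv_eqI) (simp_all flip: sp_torus_add)

lemma cis_linear_eq_1D:
  assumes "\<And>x. cis (2 * pi * (v \<bullet> x)) = 1"
  shows "v = 0"
proof (rule ccontr)
  assume "v \<noteq> 0"
  \<comment> \<open>The functional takes the value 1/2 at this multiple of \<open>v\<close>, where
    \<open>cis\<close> gives -1.\<close>
  then have "2 * pi * (v \<bullet> (v /\<^sub>R (2 * (v \<bullet> v)))) = pi" by simp
  then show False using assms[of "v /\<^sub>R (2 * (v \<bullet> v))"] by simp
qed

lemma cis_linear_eqD:
  assumes "\<And>x. cis (2 * pi * (v \<bullet> x)) = cis (2 * pi * (w \<bullet> x))"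
  shows "v = w"
proof -
  have "cis (2 * pi * ((v - w) \<bullet> x)) = 1" for x
    using assms[of x] by (simp add: inner_diff_left right_diff_distrib cis_divide[symmetric])
  then show ?thesis using cis_linear_eq_1D[of "v - w"] by simp
qed

text \<open>Conjugation by a diagonal matrix rescales each entry separately, so the matrix units are
  weight vectors, and every nonzero entry of a root vector reveals the root.\<close>

lemma sp_torus_adjoint:
  "(sp_torus x ** X ** matrix_inv (sp_torus x)) $ r $ c =
    cis (2 * pi * ((eps r - eps c) \<bullet> x)) * X $ r $ c"
proof -
  have "cis (2 * pi * ((eps r - eps c) \<bullet> x)) =
      cis (2 * pi * (eps r \<bullet> x)) * cis (2 * pi * (eps c \<bullet> - x))"
    by (simp add: cis_mult inner_diff_left right_diff_distrib)
  then show ?thesis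
    by (simp add: matrix_inv_sp_torus diagonal_mult[OF sp_torus_diagonal] sp_torus_eps)
qed

lemma symp_J_nth: "symp_J $ r $ c = (if c = flip r then if isl r then 1 else - 1 else 0)"
  by (cases r; cases c) (auto simp: symp_J_def)

lemma matrix_mult_nth: "(A ** B) $ r $ c = (\<Sum>k\<in>UNIV. A $ r $ k * B $ k $ c)"
  by (simp add: matrix_matrix_mult_def)

text \<open>As \<open>symp_J\<close> is antisymmetric, the second defining equation says that
  \<open>symp_J ** X\<close> is symmetric. The signs are those of the nonzero entries of
  \<open>symp_J\<close>.\<close>

lemma sp_lie_iff:
  "X \<in> sp_lie \<longleftrightarrow> (\<forall>r c. cnj (X $ c $ r) = - X $ r $ c) \<and>
     (\<forall>r c. X $ flip r $ c = (if isl r = isl c then 1 else - 1) * X $ flip c $ r)"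
proof -
  have l: "(symp_J ** X) $ r $ c = (if isl r then 1 else - 1) * X $ flip r $ c" for r c
    by (simp add: matrix_mult_nth symp_J_nth if_distrib[of "\<lambda>z. z * _"] sum.delta cong: if_cong)
  have r: "(transpose X ** symp_J) $ r $ c = - (if isl c then 1 else - 1) * X $ flip c $ r" for r c
  proof -
    have "(transpose X ** symp_J) $ r $ c = (\<Sum>k\<in>UNIV. if k = flip c then X $ k $ r * symp_J $ k $ c else 0)"
      unfolding matrix_mult_nth by (rule sum.cong) (auto simp: transpose_def symp_J_nth)
    also have "\<dots> = - (if isl c then 1 else - 1) * X $ flip c $ r"
      by (cases c) (simp_all add: symp_J_nth)
    finally show ?thesis .
  qed
  have nn: "- (if isl c then 1 else - 1) * a + (if isl r then 1 else - 1) * b = 0 \<longleftrightarrow>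
      b = (if isl r = isl c then 1 else - 1) * a" for a b :: complex and r c :: "'n + 'n"
    by (auto simp: complex_eq_iff)
  have "conj_transpose X + X = 0 \<longleftrightarrow> (\<forall>r c. cnj (X $ c $ r) = - X $ r $ c)"
    by (simp add: vec_eq_iff conj_transpose_def add_eq_0_iff2)
  moreover have "transpose X ** symp_J + symp_J ** X = 0 \<longleftrightarrow>
      (\<forall>r c. X $ flip r $ c = (if isl r = isl c then 1 else - 1) * X $ flip c $ r)"
    unfolding vec_eq_iff vector_add_component l r zero_index by (simp only: nn)
  ultimately show ?thesis by (simp add: sp_lie_def)
qed

text \<open>The root vector for \<open>eps u - eps v\<close> is the matrix unit at \<open>(u, v)\<close>, made symplectic by an
  entry at \<open>(flip v, flip u)\<close>.\<close>

lemma sp_roots_eq: "sp_roots = {eps r - eps c |r c. r \<noteq> c}"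
proof (intro set_eqI iffI)
  fix \<alpha> :: "real^'n"
  assume "\<alpha> \<in> sp_roots"
  then obtain X where "\<alpha> \<noteq> 0" "X \<noteq> 0" and
    X: "\<And>x. sp_torus x ** X ** matrix_inv (sp_torus x) =
        (\<chi> r c. cis (2 * pi * (\<alpha> \<bullet> x)) * X $ r $ c)"
    by (auto simp: sp_roots_def roots_def)
  obtain r c where rc: "X $ r $ c \<noteq> 0"
    using \<open>X \<noteq> 0\<close> by (auto simp: vec_eq_iff)
  have "cis (2 * pi * ((eps r - eps c) \<bullet> x)) = cis (2 * pi * (\<alpha> \<bullet> x))" for x
    using sp_torus_adjoint[of x X r c] rc by (simp add: X)
  then have "\<alpha> = eps r - eps c"
    using cis_linear_eqD by metis
  then show "\<alpha> \<in> {eps r - eps c |r c. r \<noteq> c}"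
    using \<open>\<alpha> \<noteq> 0\<close> by fastforce
next
  fix \<alpha> :: "real^'n"
  assume "\<alpha> \<in> {eps r - eps c |r c. r \<noteq> c}"
  then obtain u v where \<alpha>: "\<alpha> = eps u - eps v" and "u \<noteq> v" by blast
  \<comment> \<open>The sign that the symplectic condition imposes between the entries at
    \<open>(u, v)\<close> and \<open>(flip v, flip u)\<close>.\<close>
  define s :: complex where "s = (if isl u = isl v then - 1 else 1)"
  define E :: "'n + 'n \<Rightarrow> 'n + 'n \<Rightarrow> complex" where
    "E r c = (if r = u \<and> c = v then 1 else 0)" for r c
  define Y where "Y r c = E r c + s * E (flip c) (flip r)" for r c
  define X :: "complex^('n + 'n)^('n + 'n)" where "X = (\<chi> r c. Y r c)"
  have cnj_Y: "cnj (Y r c) = Y r c" for r c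
    by (simp add: Y_def E_def s_def)
  have sy: "Y (flip r) c = (if isl r = isl c then 1 else - 1) * Y (flip c) r" for r c
    by (auto simp: Y_def E_def s_def)
  \<comment> \<open>For a real matrix, the antisymmetric part and \<open>- \<i>\<close> times the
    symmetric part are both skew-Hermitian; this writes \<open>X\<close> as
    \<open>A + \<i> B\<close> with both parts in the Lie algebra.\<close>
  define A :: "complex^('n + 'n)^('n + 'n)" where "A = (\<chi> r c. (Y r c - Y c r) / 2)"
  define B :: "complex^('n + 'n)^('n + 'n)" where "B = (\<chi> r c. - \<i> * (Y r c + Y c r) / 2)"
  have sy': "Y c (flip r) = (if isl r = isl c then 1 else - 1) * Y r (flip c)" for r c
    using sy[of "flip c" "flip r"] by (auto split: if_splits)
  have "cnj (A $ c $ r) = - A $ r $ c" "cnj (B $ c $ r) = - B $ r $ c" for r c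
    by (simp_all add: A_def B_def cnj_Y field_simps)
  moreover have "A $ flip r $ c = (if isl r = isl c then 1 else - 1) * A $ flip c $ r"
    "B $ flip r $ c = (if isl r = isl c then 1 else - 1) * B $ flip c $ r" for r c
    using sy[of r c] sy'[of c r] by (simp_all add: A_def B_def field_simps)
  ultimately have "A \<in> sp_lie" "B \<in> sp_lie"
    unfolding sp_lie_iff by blast+
  moreover have "X = (\<chi> r c. A $ r $ c + \<i> * B $ r $ c)"
    by (simp add: vec_eq_iff X_def A_def B_def field_simps)
  ultimately have XL: "X \<in> complexification sp_lie"
    unfolding complexification_def by blast
  have X0: "X \<noteq> 0"
  proof -
    \<comment> \<open>If \<open>u = flip v\<close>, the two positions coincide; then
      \<open>s = 1\<close>, so the entries add up to 2 instead of cancelling.\<close>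
    have "Y u v \<noteq> 0"
      by (cases "u = flip v") (auto simp: Y_def E_def s_def)
    then show ?thesis
      by (auto simp: X_def vec_eq_iff)
  qed
  have adj: "sp_torus x ** X ** matrix_inv (sp_torus x) =
      (\<chi> r c. cis (2 * pi * (\<alpha> \<bullet> x)) * X $ r $ c)" for x
  proof -
    have "eps r - eps c = \<alpha>" if "X $ r $ c \<noteq> 0" for r c
    proof -
      have "(r = u \<and> c = v) \<or> (flip c = u \<and> flip r = v)"
        using that by (auto simp: X_def Y_def E_def split: if_splits)
      then show ?thesis
        by (auto simp: \<alpha>)
    qed
    then have "cis (2 * pi * ((eps r - eps c) \<bullet> x)) * X $ r $ c = cis (2 * pi * (\<alpha> \<bullet> x)) * X $ r $ c"
      for r c by (cases "X $ r $ c = 0") simp_all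
    then show ?thesis
      unfolding vec_eq_iff sp_torus_adjoint by simp
  qed
  have "\<alpha> \<noteq> 0"
    using \<open>u \<noteq> v\<close> by (simp add: \<alpha> inj_eq[OF inj_eps])
  then show "\<alpha> \<in> sp_roots"
    unfolding sp_roots_def roots_def mem_Collect_eq by (intro conjI bexI[OF _ XL] allI X0 adj)
qed

lemma finite_sp_roots: "finite sp_roots"
proof -
  have "sp_roots \<subseteq> (\<lambda>(r, c). eps r - eps c) ` UNIV"
    by (auto simp: sp_roots_eq)
  then show ?thesis
    by (rule finite_subset) simp
qed

text \<open>Unit vectors lie in the kernel of \<open>sp_torus\<close>, which forces integral
  coordinates. Conversely, an integral vector is realised by the Laurent monomial in the first
  \<open>n\<close> diagonal entries with these exponents.\<close>

lemma sp_weight_lattice: "weight_lattice (sp_torus :: real^'n::finite \<Rightarrow> _) = {w. \<forall>j. w $ j \<in> \<int>}"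
proof (intro set_eqI iffI CollectI allI)
  fix w :: "real^'n" and j
  assume "w \<in> weight_lattice sp_torus"
  then obtain f where f: "\<And>x. f (sp_torus x) = cis (2 * pi * (w \<bullet> x))"
    by (auto simp: weight_lattice_def)
  have "sp_torus (axis j 1) = sp_torus (0 :: real^'n)"
    by (auto simp: vec_eq_iff sp_torus_nth mat_def axis_def complex_eq_iff split: sum.split)
  then have "cis (2 * pi * (w $ j)) = 1"
    using f[of "axis j 1"] f[of 0] by (simp add: inner_axis)
  then have "cos (2 * pi * (w $ j)) = 1"
    by (metis cis.sel(1) one_complex.sel(1))
  then obtain k :: int where "2 * pi * (w $ j) = of_int k * 2 * pi"
    by (auto simp: cos_one_2pi_int)
  then show "w $ j \<in> \<int>" by simp
next
  fix w :: "real^'n"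
  assume "w \<in> {w. \<forall>j. w $ j \<in> \<int>}"
  then have "\<forall>j. \<exists>i. w $ j = of_int i"
    by (auto elim: Ints_cases)
  then obtain k where k: "\<And>j. w $ j = of_int (k j)"
    by metis
  define f :: "complex^('n + 'n)^('n + 'n) \<Rightarrow> complex"
    where "f A = (\<Prod>j\<in>UNIV. (A $ Inl j $ Inl j) powi (k j))" for A
  have f: "f (sp_torus x) = cis (2 * pi * (w \<bullet> x))" for x
  proof -
    have "f (sp_torus x) = (\<Prod>j\<in>UNIV. cis (of_int (k j) * (2 * pi * x $ j)))"
      by (simp add: f_def sp_torus_nth cis_power_int)
    also have "\<dots> = cis (\<Sum>j\<in>UNIV. of_int (k j) * (2 * pi * x $ j))"
      by (simp add: cis_conv_exp exp_sum sum_distrib_left)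
    also have "(\<Sum>j\<in>UNIV. of_int (k j) * (2 * pi * x $ j)) = 2 * pi * (w \<bullet> x)"
      by (simp add: inner_vec_def k sum_distrib_left mult_ac)
    finally show ?thesis .
  qed
  have "continuous_on (range sp_torus) f"
    unfolding f_def by (intro continuous_intros) (auto simp: sp_torus_nth)
  moreover have "f ` range sp_torus \<subseteq> sphere 0 1"
    by (auto simp: f)
  moreover have "\<forall>s\<in>range sp_torus. \<forall>t\<in>range sp_torus. f (s ** t) = f s * f t"
    by (auto simp: f cis_mult inner_add_right ring_distribs simp flip: sp_torus_add)
  ultimately show "w \<in> weight_lattice sp_torus"
    unfolding weight_lattice_def using f by blast
qed

section \<open>The basic inner product\<close>

lemma trace_sp_torus: "trace (sp_torus x) = of_real (2 * (\<Sum>j\<in>UNIV. cos (2 * pi * x $ j)))"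
proof -
  have "trace (sp_torus x) = (\<Sum>r\<in>UNIV <+> UNIV. sp_torus x $ r $ r)"
    by (simp add: trace_def)
  also have "\<dots> = (\<Sum>j\<in>UNIV. cis (2 * pi * x $ j)) + (\<Sum>j\<in>UNIV. cis (- (2 * pi * x $ j)))"
    by (subst sum.Plus) (simp_all add: sp_torus_nth)
  also have "\<dots> = of_real (2 * (\<Sum>j\<in>UNIV. cos (2 * pi * x $ j)))"
    by (simp add: complex_eq_iff sum_distrib_left flip: sum.distrib)
  finally show ?thesis .
qed

text \<open>By the double angle formula, \<open>1 - cos\<close> is twice the square of a sine, so
  only the derivative of \<open>sin\<close> at 0 is needed.\<close>

lemma cos_sum_limit:
  fixes x :: "real^'n::finite"
  shows "((\<lambda>t. (\<Sum>j\<in>UNIV. 1 - cos (2 * pi * (t *\<^sub>R x) $ j)) / t\<^sup>2) \<longlongrightarrow> 2 * pi\<^sup>2 * (x \<bullet> x)) (at 0)"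
proof -
  have "((\<lambda>t. (1 - cos (2 * pi * (t * y))) / t\<^sup>2) \<longlongrightarrow> 2 * pi\<^sup>2 * (y * y)) (at 0)" for y :: real
  proof -
    have "((\<lambda>t. sin (pi * (t * y))) has_real_derivative pi * y) (at 0)"
      by (auto intro!: derivative_eq_intros)
    then have "((\<lambda>t. sin (pi * (t * y)) / t) \<longlongrightarrow> pi * y) (at 0)"
      by (simp add: has_field_derivative_iff)
    then have "((\<lambda>t. 2 * (sin (pi * (t * y)) / t)\<^sup>2) \<longlongrightarrow> 2 * (pi * y)\<^sup>2) (at 0)"
      by (intro tendsto_intros)
    moreover have "2 * (sin (pi * (t * y)) / t)\<^sup>2 = (1 - cos (2 * pi * (t * y))) / t\<^sup>2" for t
      using cos_double_sin[of "pi * (t * y)"] by (simp add: power_divide mult.assoc)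
    moreover have "2 * (pi * y)\<^sup>2 = 2 * pi\<^sup>2 * (y * y)"
      by (simp add: power2_eq_square)
    ultimately show ?thesis by simp
  qed
  then have "((\<lambda>t. \<Sum>j\<in>UNIV. (1 - cos (2 * pi * (t * x $ j))) / t\<^sup>2) \<longlongrightarrow>
      (\<Sum>j\<in>UNIV. 2 * pi\<^sup>2 * (x $ j * x $ j))) (at 0)"
    by (intro tendsto_sum)
  then show ?thesis
    by (simp add: sum_divide_distrib inner_vec_def sum_distrib_left)
qed

text \<open>Conjugation preserves the trace of \<open>sp_torus (t *\<^sub>R x)\<close>, whose second order term at
  \<open>t = 0\<close> is a multiple of \<open>x \<bullet> x\<close>.\<close>

lemma weyl_group_inner:
  fixes w :: "real^'n::finite \<Rightarrow> real^'n"
  assumes "w \<in> weyl_group Sp sp_torus"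
  shows "w x \<bullet> w y = x \<bullet> y"
proof -
  obtain s g where w: "w = adjoint s" and s: "linear s" and "g \<in> Sp"
    and g: "\<And>x. g ** sp_torus x ** matrix_inv g = sp_torus (s x)"
    using assms by (auto simp: weyl_group_def)
  have inv: "conj_transpose g ** g = mat 1"
    using \<open>g \<in> Sp\<close> by (simp add: Sp_def)
  then have "g ** conj_transpose g = mat 1"
    by (simp add: matrix_left_right_inverse)
  with inv have mi: "matrix_inv g ** g = mat 1"
    by (simp add: matrix_inv_eqI)
  have tr: "trace (sp_torus (s x)) = trace (sp_torus x)" for x
  proof -
    have "trace (sp_torus (s x)) = trace (matrix_inv g ** (g ** sp_torus x))"
      by (subst trace_mul_sym) (simp add: g)
    also have "\<dots> = trace (sp_torus x)"
      by (simp add: matrix_mul_assoc mi)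
    finally show ?thesis .
  qed
  have ss: "s x \<bullet> s x = x \<bullet> x" for x
  proof -
    have "(\<Sum>j\<in>UNIV. cos (2 * pi * (t *\<^sub>R s x) $ j)) = (\<Sum>j\<in>UNIV. cos (2 * pi * (t *\<^sub>R x) $ j))" for t
    proof -
      have "trace (sp_torus (t *\<^sub>R s x)) = trace (sp_torus (t *\<^sub>R x))"
        using tr[of "t *\<^sub>R x"] by (simp add: linear_scale[OF s])
      then show ?thesis
        unfolding trace_sp_torus of_real_eq_iff by simp
    qed
    then have eq: "(\<lambda>t. (\<Sum>j\<in>UNIV. 1 - cos (2 * pi * (t *\<^sub>R s x) $ j)) / t\<^sup>2) =
        (\<lambda>t. (\<Sum>j\<in>UNIV. 1 - cos (2 * pi * (t *\<^sub>R x) $ j)) / t\<^sup>2)"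
      unfolding sum_subtractf by simp
    have "2 * pi\<^sup>2 * (s x \<bullet> s x) = 2 * pi\<^sup>2 * (x \<bullet> x)"
      by (rule tendsto_unique[OF at_neq_bot cos_sum_limit[of "s x", unfolded eq] cos_sum_limit[of x]])
    then show ?thesis by simp
  qed
  then have orth: "orthogonal_transformation s"
    by (simp add: orthogonal_transformation s norm_eq_sqrt_inner)
  \<comment> \<open>The adjoint of the isometry \<open>s\<close> is its inverse, hence an isometry
    too.\<close>
  have "s (w y) = y" for y
  proof -
    obtain z where z: "y = s z"
      using orthogonal_transformation_surj[OF orth] by (rule surjE)
    have "u \<bullet> w y = u \<bullet> z" for u
      using adjoint_works[OF s, of u y] orth by (simp add: w z orthogonal_transformation_def)
    then have "w y = z"
      using vector_eq_ldot by blast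
    then show ?thesis
      by (simp add: z)
  qed
  then show ?thesis
    using orth by (metis orthogonal_transformation_def)
qed

section \<open>Signed permutations in the Weyl group\<close>

definition monomial_matrix :: "('k \<Rightarrow> 'k) \<Rightarrow> ('k \<Rightarrow> complex) \<Rightarrow> complex^'k^'k::finite" where
  "monomial_matrix \<tau> e = (\<chi> r c. if c = \<tau> r then e r else 0)"

text \<open>Entries of modulus one make the matrix unitary. Commuting with \<open>flip\<close>
  preserves the positions of the nonzero entries of \<open>symp_J\<close>; the last assumption makes
  up for the change of their signs when \<tau> exchanges the two halves.\<close>

lemma monomial_matrix_in_Sp:
  assumes "\<And>r. \<tau> (\<tau> r) = r" and "\<And>r. \<tau> (flip r) = flip (\<tau> r)"
    and "\<And>r. cnj (e r) * e r = 1"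
    and "\<And>r. e r * e (flip r) = (if isl (\<tau> r) = isl r then 1 else - 1)"
  shows "monomial_matrix \<tau> e \<in> Sp"
proof -
  let ?g = "monomial_matrix \<tau> e"
  have inj: "\<tau> r = \<tau> c \<longleftrightarrow> r = c" for r c
    using assms(1) by metis
  have "(conj_transpose ?g ** ?g) $ r $ c = mat 1 $ r $ c" for r c
  proof -
    have "(conj_transpose ?g ** ?g) $ r $ c =
        (\<Sum>k\<in>UNIV. if k = \<tau> r then cnj (e k) * ?g $ k $ c else 0)"
      unfolding matrix_mult_nth
      by (rule sum.cong) (auto simp: conj_transpose_def monomial_matrix_def assms(1))
    also have "\<dots> = mat 1 $ r $ c"
      by (auto simp: monomial_matrix_def assms mat_def)
    finally show ?thesis .
  qed
  moreover have "(transpose ?g ** symp_J ** ?g) $ r $ c = symp_J $ r $ c" for r c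
  proof -
    have "transpose ?g ** symp_J ** ?g = transpose ?g ** (symp_J ** ?g)"
      by (simp add: matrix_mul_assoc)
    also have "(transpose ?g ** (symp_J ** ?g)) $ r $ c =
        (\<Sum>k\<in>UNIV. if k = \<tau> r then e k * (symp_J ** ?g) $ k $ c else 0)"
      unfolding matrix_mult_nth[of "transpose ?g"]
      by (rule sum.cong) (auto simp: transpose_def monomial_matrix_def assms(1))
    also have "\<dots> = e (\<tau> r) * (symp_J ** ?g) $ \<tau> r $ c" by simp
    also have "(symp_J ** ?g) $ \<tau> r $ c = (\<Sum>k\<in>UNIV. if k = \<tau> c then symp_J $ \<tau> r $ k * e k else 0)"
      unfolding matrix_mult_nth
      by (rule sum.cong) (auto simp: monomial_matrix_def assms(1))
    also have "\<dots> = symp_J $ \<tau> r $ \<tau> c * e (\<tau> c)" by simp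
    finally have 1: "(transpose ?g ** symp_J ** ?g) $ r $ c = e (\<tau> r) * (symp_J $ \<tau> r $ \<tau> c * e (\<tau> c))" .
    have "e (\<tau> r) * e (\<tau> (flip r)) * (if isl (\<tau> r) then 1 else - 1) = (if isl r then 1 else - 1)"
      using assms(4)[of "\<tau> r"] by (auto simp: assms split: if_splits)
    moreover have "\<tau> c = flip (\<tau> r) \<longleftrightarrow> c = flip r"
      by (metis assms(1,2))
    ultimately show ?thesis
      unfolding 1 symp_J_nth by (auto simp: assms(2) mult_ac)
  qed
  ultimately show ?thesis
    by (simp add: Sp_def vec_eq_iff)
qed
text \<open>Each coordinate occurs twice, with both signs, which cancel in the product. In this form
  the dot product is visibly unchanged by reindexing along a permutation of
  \<open>'n + 'n\<close>.\<close>

lemma inner_eq_eps_sum: "x \<bullet> y = (\<Sum>r\<in>UNIV. (eps r \<bullet> x) * (eps r \<bullet> y)) / 2"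
proof -
  have "(\<Sum>r\<in>UNIV. (eps r \<bullet> x) * (eps r \<bullet> y)) = (\<Sum>r\<in>UNIV <+> UNIV. (eps r \<bullet> x) * (eps r \<bullet> y))"
    by simp
  also have "\<dots> = (\<Sum>j\<in>UNIV. x $ j * y $ j) + (\<Sum>j\<in>UNIV. x $ j * y $ j)"
    by (subst sum.Plus) (simp_all add: inner_axis')
  finally show ?thesis by (simp add: inner_vec_def)
qed

lemma eq_if_eps_inner_eq:
  assumes "\<And>r. eps r \<bullet> x = eps r \<bullet> y"
  shows "x = y"
proof -
  have "x \<bullet> z = y \<bullet> z" for z
    unfolding inner_eq_eps_sum[of x z] inner_eq_eps_sum[of y z] assms ..
  then show ?thesis
    using vector_eq_rdot by blast
qed

text \<open>Sign changes and transpositions are involutions, and an involutive signed permutation is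
  self-adjoint, so that the transpose in \<open>weyl_group\<close> does no harm.\<close>

lemma signed_permutation_in_weyl_group:
  fixes \<tau> :: "'n + 'n \<Rightarrow> 'n::finite + 'n"
  assumes inv: "\<And>r. \<tau> (\<tau> r) = r" and flip: "\<And>r. \<tau> (flip r) = flip (\<tau> r)"
  obtains s where "s \<in> weyl_group Sp sp_torus" "\<And>r. s (eps r) = eps (\<tau> r)"
proof
  define s :: "real^'n \<Rightarrow> real^'n" where "s x = (\<chi> j. eps (\<tau> (Inl j)) \<bullet> x)" for x
  have s: "eps r \<bullet> s x = eps (\<tau> r) \<bullet> x" for r x
  proof (cases r)
    case (Inr j)
    then have "\<tau> r = flip (\<tau> (Inl j))" using flip[of "Inl j"] by simp
    then show ?thesis by (simp add: Inr s_def inner_axis')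
  qed (simp add: s_def inner_axis')
  have bij: "bij \<tau>"
    using inv by (metis bij_betw_byWitness subset_UNIV UNIV_I)
  have "s x \<bullet> y = x \<bullet> s y" for x y
  proof -
    have "(\<Sum>r\<in>UNIV. (eps (\<tau> r) \<bullet> x) * (eps r \<bullet> y)) =
        (\<Sum>r\<in>UNIV. (eps (\<tau> (\<tau> r)) \<bullet> x) * (eps (\<tau> r) \<bullet> y))"
      by (rule sum.reindex_bij_betw[OF bij, symmetric])
    then show ?thesis
      unfolding inner_eq_eps_sum[of "s x" y] inner_eq_eps_sum[of x "s y"] by (simp add: s inv)
  qed
  then have adj: "adjoint s = s"
    by (intro adjoint_unique) simp
  have lin: "linear s"
    by (rule linearI) (simp_all add: s_def vec_eq_iff inner_add_right)
  \<comment> \<open>In each pair \<open>r\<close>, \<open>flip r\<close> that \<tau> moves to the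
    other half, exactly the left member gets the sign -1.\<close>
  define e :: "'n + 'n \<Rightarrow> complex" where "e r = (if isl r \<and> \<not> isl (\<tau> r) then - 1 else 1)" for r
  define g where "g = monomial_matrix \<tau> e"
  have "g \<in> Sp"
    unfolding g_def by (rule monomial_matrix_in_Sp) (auto simp: inv flip e_def)
  then have "conj_transpose g ** g = mat 1"
    by (simp add: Sp_def)
  moreover from this have "g ** conj_transpose g = mat 1"
    by (simp add: matrix_left_right_inverse)
  ultimately have gi: "g ** matrix_inv g = mat 1"
    by (simp add: matrix_inv_eqI)
  have "g ** sp_torus x = sp_torus (s x) ** g" for x
    by (simp add: vec_eq_iff diagonal_mult[OF sp_torus_diagonal] g_def monomial_matrix_def
        sp_torus_eps s)
  then have "g ** sp_torus x ** matrix_inv g = sp_torus (s x)" for x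
    by (simp add: gi flip: matrix_mul_assoc)
  then show "s \<in> weyl_group Sp sp_torus"
    unfolding weyl_group_def using lin adj \<open>g \<in> Sp\<close> by force
  show "s (eps r) = eps (\<tau> r)" for r
  proof (rule eq_if_eps_inner_eq)
    fix c
    have "\<tau> c = r \<longleftrightarrow> c = \<tau> r" "\<tau> c = flip r \<longleftrightarrow> c = flip (\<tau> r)"
      by (metis inv flip)+
    then show "eps c \<bullet> s (eps r) = eps c \<bullet> eps (\<tau> r)"
      by (simp add: s eps_inner)
  qed
qed

text \<open>In the dot product, roots have squared length 2 or 4, and 4 is attained by the doubled
  \<open>eps r\<close>. A positive scalar \<open>b\<close> does not affect which roots are long, so
  this serves both to verify the normalisation and to determine \<open>b\<close>.\<close>

lemma
  fixes b :: real and u :: "real^'n::finite" and r :: "'n + 'n"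
  assumes "b > 0"
  shows long_root_inner: "u \<in> long_roots (\<lambda>x y. b * (x \<bullet> y)) sp_roots \<Longrightarrow> u \<bullet> u = 4"
    and double_eps_long_root: "2 *\<^sub>R eps r \<in> long_roots (\<lambda>x y. b * (x \<bullet> y)) sp_roots"
proof -
  have le: "v \<bullet> v \<le> 4" if "v \<in> sp_roots" for v :: "real^'n"
    using that by (auto simp: sp_roots_eq inner_diff_left inner_diff_right eps_inner)
  have dbl: "2 *\<^sub>R eps r \<in> sp_roots" for r :: "'n + 'n"
    unfolding sp_roots_eq mem_Collect_eq
    by (rule exI[of _ r], rule exI[of _ "flip r"]) (simp add: scaleR_2)
  have d4: "(2 *\<^sub>R eps r) \<bullet> (2 *\<^sub>R eps r) = 4" for r :: "'n + 'n"
    by (simp add: eps_inner)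
  show "u \<bullet> u = 4" if "u \<in> long_roots (\<lambda>x y. b * (x \<bullet> y)) sp_roots"
  proof -
    have "b * ((2 *\<^sub>R eps r) \<bullet> (2 *\<^sub>R eps r)) \<le> b * (u \<bullet> u)" for r :: "'n + 'n"
      using that dbl unfolding long_roots_def by blast
    then have "4 \<le> u \<bullet> u"
      using assms by (simp add: eps_inner)
    then show ?thesis
      using le[of u] that by (simp add: long_roots_def)
  qed
  show "2 *\<^sub>R eps r \<in> long_roots (\<lambda>x y. b * (x \<bullet> y)) sp_roots"
    unfolding long_roots_def mem_Collect_eq d4 using assms le dbl by simp
qed

text \<open>Invariance under the sign changes makes the basis vectors orthogonal for \<open>B\<close>, and
  invariance under the transpositions gives them the same length.\<close>

lemma invariant_inner_product:
  fixes B :: "real^'n::finite \<Rightarrow> real^'n \<Rightarrow> real"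
  assumes B: "is_inner_product B"
    and inv: "\<And>s x y. s \<in> weyl_group Sp sp_torus \<Longrightarrow> B (s x) (s y) = B x y"
  obtains b where "b > 0" "B = (\<lambda>x y. b * (x \<bullet> y))"
proof
  fix k :: 'n
  have bil: "bilinear B" and pos: "\<And>x. x \<noteq> 0 \<Longrightarrow> B x x > 0"
    using B by (auto simp: is_inner_product_def)
  define b where "b = B (axis k 1) (axis k 1)"
  show "b > 0"
    unfolding b_def by (rule pos) (simp add: axis_eq_0_iff)
  have inv_eps: "B (eps (\<tau> r)) (eps (\<tau> c)) = B (eps r) (eps c)"
    if "\<And>r. \<tau> (\<tau> r) = r" "\<And>r. \<tau> (flip r) = flip (\<tau> r)" for \<tau> and r c :: "'n + 'n"
    by (rule signed_permutation_in_weyl_group[OF that]) (use inv in metis)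
  have off: "B (axis i 1) (axis j 1) = 0" if "i \<noteq> j" for i j :: 'n
  proof -
    define \<tau> :: "'n + 'n \<Rightarrow> 'n + 'n" where "\<tau> r = (if r \<in> {Inl i, Inr i} then flip r else r)" for r
    have f: "flip r \<in> {Inl i, Inr i} \<longleftrightarrow> r \<in> {Inl i, Inr i}" for r
      by (cases r) auto
    have "B (eps (\<tau> (Inl i))) (eps (\<tau> (Inl j))) = B (eps (Inl i)) (eps (Inl j))"
      by (rule inv_eps) (simp_all only: \<tau>_def f flip_simps if_cancel split: if_split, simp_all)
    then show ?thesis
      using that by (simp add: \<tau>_def bilinear_lneg[OF bil])
  qed
  have diag: "B (axis i 1) (axis i 1) = b" for i :: 'n
  proof -
    define \<sigma> where "\<sigma> j = (if j = i then k else if j = k then i else j)" for j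
    have \<sigma>: "\<sigma> (\<sigma> j) = j" for j by (simp add: \<sigma>_def)
    have "B (eps (map_sum \<sigma> \<sigma> (Inl i))) (eps (map_sum \<sigma> \<sigma> (Inl i))) = B (eps (Inl i)) (eps (Inl i))"
      by (rule inv_eps; case_tac r) (simp_all add: \<sigma>)
    then show ?thesis by (simp add: \<sigma>_def b_def)
  qed
  show "B = (\<lambda>x y. b * (x \<bullet> y))"
  proof -
    have "bilinear (\<lambda>x y :: real^'n. b * (x \<bullet> y))"
      by (auto simp: bilinear_def algebra_simps inner_add_left inner_add_right intro!: linearI)
    then show ?thesis
      by (rule bilinear_eq_stdbasis[OF bil]) (auto simp: Basis_vec_def inner_axis_axis off diag)
  qed
qed

lemma sp_basic_inner:
  fixes x y :: "real^'n::finite"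
  shows "basic_inner sp_roots (weyl_group Sp sp_torus) x y = x \<bullet> y / 2"
proof -
  let ?B = "\<lambda>x y :: real^'n. 1 / 2 * (x \<bullet> y)"
  have "basic_inner sp_roots (weyl_group Sp sp_torus) = ?B"
    unfolding basic_inner_def
  proof (rule the_equality, intro conjI ballI allI)
    show "is_inner_product ?B"
      unfolding is_inner_product_def
      by (auto simp: bilinear_def algebra_simps inner_add_left inner_add_right inner_commute
          intro!: linearI)
    show "?B (s x) (s y) = ?B x y" if "s \<in> weyl_group Sp sp_torus" for s x y
      by (simp add: weyl_group_inner[OF that])
    show "?B u u = 2" if "u \<in> long_roots ?B sp_roots" for u
      using long_root_inner[OF _ that] by simp
  next
    fix B :: "real^'n \<Rightarrow> real^'n \<Rightarrow> real"
    assume *: "is_inner_product B \<and> (\<forall>s\<in>weyl_group Sp sp_torus. \<forall>x y. B (s x) (s y) = B x y) \<and>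
        (\<forall>u\<in>long_roots B sp_roots. B u u = 2)"
    then obtain b where b: "b > 0" and B: "B = (\<lambda>x y. b * (x \<bullet> y))"
      using invariant_inner_product[of B] by blast
    fix j :: 'n
    \<comment> \<open>A long root has squared length \<open>4 * b\<close>, and this must be
      2.\<close>
    have "B (2 *\<^sub>R eps (Inl j)) (2 *\<^sub>R eps (Inl j)) = 2"
      using * double_eps_long_root[OF b] unfolding B by blast
    then have "b = 1 / 2"
      unfolding B by (simp add: inner_axis_axis)
    then show "B = ?B"
      by (simp only: B)
  qed
  then show ?thesis by simp
qed

section \<open>Regular weights\<close>

lemma interior_INT_finite:
  "finite I \<Longrightarrow> interior (\<Inter>i\<in>I. S i) = (\<Inter>i\<in>I. interior (S i))"
  by (induction rule: finite_induct) simp_all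

text \<open>Each root is a sum \<open>u + v\<close> of two vectors among the \<open>eps r\<close>.  With \<open>eps r0\<close> the maximal one,
  \<open>2 eps r0 - (u + v) = (eps r0 - u) + (eps r0 - v)\<close>, where each summand is zero or a positive root.\<close>

lemma sp_highest_root:
  assumes h: "\<forall>\<alpha>\<in>sp_roots. \<alpha> \<bullet> h \<noteq> 0" and P: "P = {\<alpha>\<in>sp_roots. \<alpha> \<bullet> h > 0}"
    and r0: "\<And>r. eps r \<bullet> h \<le> eps r0 \<bullet> h"
  shows "highest_root sp_roots P = 2 *\<^sub>R eps r0"
  unfolding highest_root_def
proof (rule the_equality, intro conjI ballI)
  have fin: "finite P"
    by (simp add: P finite_sp_roots)
  show "2 *\<^sub>R eps r0 \<in> sp_roots"
    unfolding sp_roots_eq mem_Collect_eq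
    by (rule exI[of _ r0], rule exI[of _ "flip r0"]) (simp add: scaleR_2)
  show top: "\<exists>c::_ \<Rightarrow> nat. 2 *\<^sub>R eps r0 - \<alpha> = (\<Sum>\<beta>\<in>P. real (c \<beta>) *\<^sub>R \<beta>)"
    if "\<alpha> \<in> sp_roots" for \<alpha>
  proof -
    obtain r c where \<alpha>: "\<alpha> = eps r - eps c"
      using \<open>\<alpha> \<in> sp_roots\<close> by (auto simp: sp_roots_eq)
    have pos: "eps r0 - eps r = 0 \<or> eps r0 - eps r \<in> P" for r
    proof (cases "r = r0")
      case False
      then have "eps r0 - eps r \<in> sp_roots"
        by (auto simp: sp_roots_eq)
      moreover from this have "(eps r0 - eps r) \<bullet> h \<noteq> 0"
        using h by blast
      ultimately show ?thesis
        using r0[of r] by (simp add: P inner_diff_left)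
    qed simp
    have single: "\<exists>c::_ \<Rightarrow> nat. x = (\<Sum>\<beta>\<in>P. real (c \<beta>) *\<^sub>R \<beta>)" if "x = 0 \<or> x \<in> P" for x
      using that
    proof
      assume "x \<in> P"
      have "(\<Sum>\<beta>\<in>P. real (if \<beta> = x then 1 else 0) *\<^sub>R \<beta>) = (\<Sum>\<beta>\<in>P. if \<beta> = x then \<beta> else 0)"
        by (rule sum.cong) simp_all
      then show ?thesis
        using \<open>x \<in> P\<close> fin by (intro exI[of _ "\<lambda>\<beta>. if \<beta> = x then 1 else 0"]) simp
    qed (auto intro: exI[of _ "\<lambda>_. 0"])
    obtain c1 :: "_ \<Rightarrow> nat" where c1: "eps r0 - eps r = (\<Sum>\<beta>\<in>P. real (c1 \<beta>) *\<^sub>R \<beta>)"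
      using single[OF pos[of r]] by blast
    obtain c2 :: "_ \<Rightarrow> nat" where c2: "eps r0 - eps (flip c) = (\<Sum>\<beta>\<in>P. real (c2 \<beta>) *\<^sub>R \<beta>)"
      using single[OF pos[of "flip c"]] by blast
    have "2 *\<^sub>R eps r0 - \<alpha> = (eps r0 - eps r) + (eps r0 - eps (flip c))"
      by (simp add: \<alpha> scaleR_2)
    also have "\<dots> = (\<Sum>\<beta>\<in>P. real (c1 \<beta>) *\<^sub>R \<beta>) + (\<Sum>\<beta>\<in>P. real (c2 \<beta>) *\<^sub>R \<beta>)"
      by (simp only: c1 c2)
    also have "\<dots> = (\<Sum>\<beta>\<in>P. real (c1 \<beta> + c2 \<beta>) *\<^sub>R \<beta>)"
      by (simp add: scaleR_add_left sum.distrib)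
    finally show ?thesis
      by (intro exI[of _ "\<lambda>\<beta>. c1 \<beta> + c2 \<beta>"])
  qed
  show "\<theta> = 2 *\<^sub>R eps r0"
    if \<theta>: "\<theta> \<in> sp_roots \<and> (\<forall>\<alpha>\<in>sp_roots. \<exists>c::_ \<Rightarrow> nat. \<theta> - \<alpha> = (\<Sum>\<beta>\<in>P. real (c \<beta>) *\<^sub>R \<beta>))" for \<theta>
  proof -
    obtain c where c: "2 *\<^sub>R eps r0 - \<theta> = (\<Sum>\<beta>\<in>P. real (c \<beta>) *\<^sub>R \<beta>)"
      using top[of \<theta>] \<theta> by blast
    obtain d where d: "\<theta> - 2 *\<^sub>R eps r0 = (\<Sum>\<beta>\<in>P. real (d \<beta>) *\<^sub>R \<beta>)"
      using \<theta> \<open>2 *\<^sub>R eps r0 \<in> sp_roots\<close> by blast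
    \<comment> \<open>The two expansions add up to a vanishing combination of positive roots with
      natural coefficients. Pairing with \<open>h\<close>, which is positive on each of them, makes
      all coefficients zero.\<close>
    have "(\<Sum>\<beta>\<in>P. real (c \<beta> + d \<beta>) *\<^sub>R \<beta>) = 0"
      by (simp add: scaleR_add_left sum.distrib flip: c d)
    then have "(\<Sum>\<beta>\<in>P. real (c \<beta> + d \<beta>) *\<^sub>R \<beta>) \<bullet> h = 0" by simp
    then have "(\<Sum>\<beta>\<in>P. real (c \<beta> + d \<beta>) * (\<beta> \<bullet> h)) = 0"
      by (simp add: inner_sum_left)
    moreover have "\<forall>\<beta>\<in>P. 0 \<le> real (c \<beta> + d \<beta>) * (\<beta> \<bullet> h)"
      by (auto simp: P)
    ultimately have "\<forall>\<beta>\<in>P. real (c \<beta> + d \<beta>) * (\<beta> \<bullet> h) = 0"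
      using fin by (simp add: sum_nonneg_eq_0_iff)
    then have "\<forall>\<beta>\<in>P. d \<beta> = 0"
      by (auto simp: P)
    then show ?thesis using d by simp
  qed
qed

text \<open>The alcove is a finite intersection of half-spaces with nonzero normals, so its interior
  is given by the strict inequalities. Bounding all \<open>eps r \<bullet> a\<close> instead of the
  largest one removes the dependence on the highest root.\<close>

lemma sp_regular_weights:
  fixes h :: "real^'n::finite"
  assumes h: "\<forall>\<alpha>\<in>sp_roots. \<alpha> \<bullet> h \<noteq> 0" and P: "P = {\<alpha>\<in>sp_roots. \<alpha> \<bullet> h > 0}"
  shows "regular_weights (weight_lattice sp_torus) sp_roots (weyl_group Sp sp_torus) P m =
    {a. (\<forall>j. a $ j \<in> \<int>) \<and> (\<forall>r c. eps r \<bullet> h > eps c \<bullet> h \<longrightarrow> eps r \<bullet> a > eps c \<bullet> a) \<and>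
        (\<forall>r. eps r \<bullet> a < real m)}"
proof -
  have "Max (range (\<lambda>r. eps r \<bullet> h)) \<in> range (\<lambda>r. eps r \<bullet> h)"
    by (rule Max_in) simp_all
  then obtain r0 where "Max (range (\<lambda>r. eps r \<bullet> h)) = eps r0 \<bullet> h"
    by blast
  then have r0: "eps r \<bullet> h \<le> eps r0 \<bullet> h" for r
    by (metis Max_ge finite finite_imageI rangeI)
  have fin: "finite P"
    by (simp add: P finite_sp_roots)
  let ?A = "alcove (basic_inner sp_roots (weyl_group Sp sp_torus)) P (highest_root sp_roots P) m"
  have "?A = (\<Inter>\<alpha>\<in>P. {x. \<alpha> \<bullet> x \<ge> 0}) \<inter> {x. eps r0 \<bullet> x \<le> real m}"
    by (auto simp: alcove_def weyl_chamber_def sp_basic_inner sp_highest_root[OF h P r0])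
  moreover have "\<alpha> \<noteq> 0" if "\<alpha> \<in> P" for \<alpha>
    using that by (auto simp: P)
  moreover have "eps r0 \<noteq> 0"
    using norm_eps[of r0] by fastforce
  ultimately have int: "interior ?A = (\<Inter>\<alpha>\<in>P. {x. \<alpha> \<bullet> x > 0}) \<inter> {x. eps r0 \<bullet> x < real m}"
    by (simp add: interior_INT_finite[OF fin])
  have "a \<in> interior ?A \<longleftrightarrow> (\<forall>r c. eps r \<bullet> h > eps c \<bullet> h \<longrightarrow> eps r \<bullet> a > eps c \<bullet> a) \<and>
        (\<forall>r. eps r \<bullet> a < real m)" for a
  proof -
    have "P = {eps r - eps c |r c. eps r \<bullet> h > eps c \<bullet> h}"
      by (auto simp: P sp_roots_eq inner_diff_left) blast
    then have 1: "(\<forall>\<alpha>\<in>P. \<alpha> \<bullet> a > 0) \<longleftrightarrow> (\<forall>r c. eps r \<bullet> h > eps c \<bullet> h \<longrightarrow> eps r \<bullet> a > eps c \<bullet> a)"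
      by (force simp: inner_diff_left)
    \<comment> \<open>The index that is maximal for \<open>h\<close> is also maximal for
      \<open>a\<close>.\<close>
    have "eps r \<bullet> a \<le> eps r0 \<bullet> a" if *: "\<forall>\<alpha>\<in>P. \<alpha> \<bullet> a > 0" for r
    proof (cases "r = r0")
      case False
      then have "eps r0 - eps r \<in> sp_roots"
        by (auto simp: sp_roots_eq)
      then have "(eps r0 - eps r) \<bullet> h \<noteq> 0"
        using h by blast
      then have "eps r \<bullet> h < eps r0 \<bullet> h"
        using r0[of r] by (simp add: inner_diff_left)
      then show ?thesis
        using * 1 by force
    qed simp
    then show ?thesis
      unfolding int by (auto simp flip: 1 intro: le_less_trans)
  qed
  then show ?thesis
    by (auto simp: regular_weights_def sp_weight_lattice)
qed

text \<open>The denominator in lowest terms divides any power of \<open>p\<close> that clears it,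
  and divisors of a prime power are again powers of \<open>p\<close>.\<close>

lemma denom_power_iff:
  assumes "prime p"
  shows "denom_power p x \<longleftrightarrow> (\<exists>k. x * real p ^ k \<in> \<int>)"
proof
  assume "denom_power p x"
  then obtain q k where x: "x = of_rat q" and k: "snd (quotient_of q) = int p ^ k"
    by (auto simp: denom_power_def)
  obtain a b where ab: "quotient_of q = (a, b)" by force
  have "x = of_int a / of_int b"
    using quotient_of_div[OF ab] by (simp add: x of_rat_divide)
  then have "x * real p ^ k = of_int a"
    using k ab quotient_of_denom_pos[OF ab] by simp
  then show "\<exists>k. x * real p ^ k \<in> \<int>"
    by (metis Ints_of_int)
next
  assume "\<exists>k. x * real p ^ k \<in> \<int>"
  then obtain k z where z: "x * real p ^ k = of_int z"
    by (auto elim: Ints_cases)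
  have p: "p > 0"
    using assms by (simp add: prime_gt_0_nat)
  define q where "q = rat_of_int z / of_nat (p ^ k)"
  have x: "x = of_rat q"
    using z p by (simp add: q_def of_rat_divide of_rat_power field_simps)
  obtain a b where ab: "quotient_of q = (a, b)" by force
  have b: "b > 0" and co: "coprime a b"
    using quotient_of_denom_pos[OF ab] quotient_of_coprime[OF ab] by auto
  have "rat_of_int z / of_nat (p ^ k) = of_int a / of_int b"
    using quotient_of_div[OF ab] by (simp add: q_def)
  then have "rat_of_int (z * b) = of_int (a * int p ^ k)"
    using b p by (simp add: field_simps)
  then have "z * b = a * int p ^ k"
    by (simp only: of_int_eq_iff)
  then have "b dvd a * int p ^ k"
    by (metis dvd_triv_right)
  then have "b dvd int p ^ k"
    using co by (simp add: coprime_dvd_mult_right_iff coprime_commute)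
  then have "nat b dvd p ^ k"
    using b by (metis int_dvd_int_iff int_nat_eq less_imp_le of_nat_power)
  then obtain l where "nat b = p ^ l"
    using assms by (auto simp: divides_primepow_nat)
  then have "b = int p ^ l"
    using b by (metis int_nat_eq less_imp_le of_nat_power)
  then show "denom_power p x"
    unfolding denom_power_def using x ab by (metis snd_conv)
qed

text \<open>The part of 2 prime to \<open>p\<close>; thus \<open>m' * step p\<close> is the part of
  \<open>2 * m\<close> prime to \<open>p\<close> when \<open>m = p ^ i * m'\<close> and
  \<open>p\<close> does not divide \<open>m'\<close>.\<close>

definition step :: "nat \<Rightarrow> int" where
  "step p = (if p = 2 then 1 else 2)"

text \<open>The unit weights already force the divisibility, since a factor prime to
  \<open>p\<close> cannot be absorbed by a power of \<open>p\<close>. It then holds for every weight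
  because pairings are integral combinations of the coordinates.\<close>

lemma denom_power_weights_iff:
  fixes a :: "real^'n::finite"
  assumes a: "\<forall>j. a $ j \<in> \<int>" and p: "prime p" and m: "m = p ^ i * m'" "m > 0" and m': "\<not> p dvd m'"
  shows "(\<forall>w\<in>weight_lattice sp_torus. denom_power p (w \<bullet> a / 2 / real m)) \<longleftrightarrow>
    (\<forall>j. \<exists>z. a $ j = of_int (int m' * (step p * z)))"
proof (intro iffI allI ballI)
  fix j
  assume *: "\<forall>w\<in>weight_lattice sp_torus. denom_power p (w \<bullet> a / 2 / real m)"
  have "axis j 1 \<in> weight_lattice (sp_torus :: real^'n \<Rightarrow> _)"
    by (simp add: sp_weight_lattice axis_def)
  from *[rule_format, OF this] have "\<exists>k. a $ j / 2 / real m * real p ^ k \<in> \<int>"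
    by (simp add: denom_power_iff[OF p] inner_axis')
  then obtain k z where z: "a $ j / 2 / real m * real p ^ k = of_int z"
    by (auto elim: Ints_cases)
  obtain t where t: "a $ j = of_int t"
    using a by (auto elim: Ints_cases)
  have "of_int (t * int p ^ k) = (of_int (2 * int m * z) :: real)"
    using z m(2) by (simp add: t field_simps)
  then have "t * int p ^ k = 2 * int m * z"
    by (simp only: of_int_eq_iff)
  also have "\<dots> = int m' * 2 * (int p ^ i * z)"
    by (simp add: m(1))
  finally have "int m' * 2 dvd t * int p ^ k"
    by simp
  moreover have "int m' * step p dvd int m' * 2"
    by (simp add: step_def)
  ultimately have "int m' * step p dvd t * int p ^ k"
    by (rule dvd_trans[rotated])
  moreover have "coprime (int m' * step p) (int p ^ k)"
  proof -
    have "coprime m' p"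
      using prime_imp_coprime_nat[OF p m'] by (simp add: coprime_commute)
    moreover have "coprime (int 2) (int p)" if "p \<noteq> 2"
      unfolding coprime_int_iff using that p by (intro primes_coprime) simp_all
    ultimately show ?thesis
      by (simp add: step_def)
  qed
  ultimately have "int m' * step p dvd t"
    using coprime_dvd_mult_left_iff by blast
  then show "\<exists>z. a $ j = of_int (int m' * (step p * z))"
    unfolding t of_int_eq_iff by (auto simp: mult.assoc)
next
  fix w :: "real^'n"
  assume "\<forall>j. \<exists>z. a $ j = of_int (int m' * (step p * z))"
  then obtain v where v: "\<And>j. a $ j = of_int (int m' * (step p * v j))"
    by metis
  assume "w \<in> weight_lattice sp_torus"
  then have w: "w $ j \<in> \<int>" for j
    by (simp add: sp_weight_lattice)
  define S where "S = (\<Sum>j\<in>UNIV. w $ j * of_int (v j))"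
  have S: "S \<in> \<int>"
    unfolding S_def by (intro Ints_sum Ints_mult w Ints_of_int)
  have wa: "w \<bullet> a = real m' * of_int (step p) * S"
    by (simp add: inner_vec_def v S_def sum_distrib_left mult_ac)
  have "\<exists>k. w \<bullet> a / 2 / real m * real p ^ k = S"
  proof (intro exI)
    \<comment> \<open>For \<open>p = 2\<close> one more power is needed to clear the 2 from the
      inner product.\<close>
    show "w \<bullet> a / 2 / real m * real p ^ (if p = 2 then Suc i else i) = S"
      using m by (auto simp: wa step_def)
  qed
  then show "denom_power p (w \<bullet> a / 2 / real m)"
    using S by (auto simp: denom_power_iff[OF p])
qed

section \<open>Counting\<close>

text \<open>A strictly decreasing list is determined by its set of entries.\<close>

lemma card_strictly_decreasing_lists:
  fixes T :: "'a::linorder set"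
  assumes "finite T"
  shows "card {b. length b = n \<and> sorted_wrt (>) b \<and> set b \<subseteq> T} = card T choose n"
proof -
  have dec: "sorted_wrt (>) b \<longleftrightarrow> sorted_wrt (<) (rev b)" for b :: "'a list"
    by (simp add: sorted_wrt_rev)
  have "bij_betw set {b. length b = n \<and> sorted_wrt (>) b \<and> set b \<subseteq> T} {B. B \<subseteq> T \<and> card B = n}"
  proof (rule bij_betw_byWitness[where f' = "\<lambda>B. rev (sorted_list_of_set B)"])
    have "rev (sorted_list_of_set (set b)) = b" if "sorted_wrt (>) b" for b :: "'a list"
      using sorted_list_of_set.idem_if_sorted_distinct[of "rev b"] that
      by (simp add: dec strict_sorted_iff)
    then show "\<forall>b\<in>{b. length b = n \<and> sorted_wrt (>) b \<and> set b \<subseteq> T}. rev (sorted_list_of_set (set b)) = b"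
      by blast
  qed (use assms in \<open>auto simp: dec strict_sorted_iff finite_subset distinct_card\<close>)
  then show ?thesis
    by (simp add: bij_betw_same_card n_subsets[OF assms])
qed

lemma obtain_decreasing_enumeration:
  fixes f :: "'a \<Rightarrow> 'b::linorder"
  assumes "finite A" "inj_on f A"
  obtains xs where "distinct xs" "set xs = A" "sorted_wrt (\<lambda>x y. f x > f y) xs"
proof
  define ys where "ys = rev (sorted_list_of_set (f ` A))"
  define xs where "xs = map (inv_into A f) ys"
  have ys: "set ys = f ` A" "sorted_wrt (>) ys"
    using assms(1) by (simp_all add: ys_def sorted_wrt_rev)
  have f: "map f xs = ys"
    unfolding xs_def map_map by (rule map_idI) (simp add: ys(1) f_inv_into_f)
  show "sorted_wrt (\<lambda>x y. f x > f y) xs"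
    using ys(2) by (simp flip: f add: sorted_wrt_map)
  show "set xs = A"
    using assms(2) by (simp add: xs_def ys(1) image_comp)
  show "distinct xs"
    using f by (metis distinct_map distinct_rev sorted_list_of_set.distinct_sorted_key_list_of_set ys_def)
qed

text \<open>The positive half \<open>{r. eps r \<bullet> h > 0}\<close> contains exactly one of \<open>r\<close>, \<open>flip r\<close>.  Listed by
  decreasing \<open>h\<close>, it turns a weight in the open alcove into a strictly decreasing list.\<close>

lemma alcove_iff_decreasing:
  fixes h a :: "real^'n::finite" and m :: real
  assumes h: "\<And>r :: 'n + 'n. eps r \<bullet> h \<noteq> 0" and m: "m > 0"
    and rs: "set rs = {r. eps r \<bullet> h > 0}" "sorted_wrt (\<lambda>r c. eps r \<bullet> h > eps c \<bullet> h) rs"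
  shows "(\<forall>r c. eps r \<bullet> h > eps c \<bullet> h \<longrightarrow> eps r \<bullet> a > eps c \<bullet> a) \<and> (\<forall>r. eps r \<bullet> a < m) \<longleftrightarrow>
    sorted_wrt (>) ([m] @ map (\<lambda>r. eps r \<bullet> a) rs @ [0])"
    (is "?L \<longleftrightarrow> ?R")
proof
  assume L: ?L
  have "sorted_wrt (\<lambda>r c. eps r \<bullet> a > eps c \<bullet> a) rs"
    by (rule sorted_wrt_mono_rel[OF _ rs(2)]) (use L in blast)
  moreover have "eps r \<bullet> a > 0" if "r \<in> set rs" for r
  proof -
    \<comment> \<open>The positive root used here is the long one,
      \<open>eps r - eps (flip r)\<close>.\<close>
    have "eps r \<bullet> h > eps (flip r) \<bullet> h"
      using that by (simp add: rs(1))
    then have "eps r \<bullet> a > eps (flip r) \<bullet> a"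
      using L by blast
    then show ?thesis by simp
  qed
  ultimately show ?R
    using L m by (auto simp: sorted_wrt_append sorted_wrt_map)
next
  assume R: ?R
  have dec: "sorted_wrt (\<lambda>r c. eps r \<bullet> a > eps c \<bullet> a) rs"
    and pos: "\<And>r. r \<in> set rs \<Longrightarrow> eps r \<bullet> a > 0" and less: "\<And>r. r \<in> set rs \<Longrightarrow> eps r \<bullet> a < m"
    using R by (auto simp: sorted_wrt_append sorted_wrt_map)
  have half: "flip r \<in> set rs" if "r \<notin> set rs" for r
    using h[of r] that by (simp add: rs(1))
  have in_rs: "eps r \<bullet> a > eps c \<bullet> a"
    if "r \<in> set rs" "c \<in> set rs" "eps r \<bullet> h > eps c \<bullet> h" for r c
  proof -
    obtain i j where ij: "i < length rs" "rs ! i = r" "j < length rs" "rs ! j = c"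
      using \<open>r \<in> set rs\<close> \<open>c \<in> set rs\<close> unfolding in_set_conv_nth by blast
    have "\<not> j \<le> i"
    proof
      assume "j \<le> i"
      then have "j = i \<or> eps c \<bullet> h > eps r \<bullet> h"
        using sorted_wrt_nth_less[OF rs(2), of j i] ij by (cases "j = i") auto
      then show False using that ij by auto
    qed
    then show ?thesis
      using sorted_wrt_nth_less[OF dec, of i j] ij by simp
  qed
  \<comment> \<open>Outside \<open>rs\<close> the values are negatives of those inside, for
    \<open>h\<close> and \<open>a\<close> alike. Mixed pairs are decided by sign, and for two
    indices outside, negation turns the pair into \<open>flip c\<close>,
    \<open>flip r\<close>.\<close>
  have "eps r \<bullet> a > eps c \<bullet> a" if rc: "eps r \<bullet> h > eps c \<bullet> h" for r c
  proof (cases "r \<in> set rs"; cases "c \<in> set rs")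
    assume "r \<in> set rs" "c \<notin> set rs"
    then show ?thesis
      using pos[of r] pos[OF half, of c] by simp
  next
    assume "r \<notin> set rs" "c \<in> set rs"
    then show ?thesis
      using rc by (simp add: rs(1))
  next
    assume "r \<notin> set rs" "c \<notin> set rs"
    then show ?thesis
      using in_rs[OF half half, of c r] rc by simp
  qed (use in_rs rc in blast)
  moreover have "eps r \<bullet> a < m" for r
    using less[of r] pos[OF half, of r] m by (cases "r \<in> set rs") simp_all
  ultimately show ?L by blast
qed

text \<open>The positive half picks one of the two signs of each unit vector, hence a basis, on
  which values may be prescribed freely. This makes the passage from weights to lists
  surjective.\<close>

lemma weight_with_coordinates_exists:
  fixes h :: "real^'n::finite" and f :: "'n + 'n \<Rightarrow> real"
  shows "\<exists>a. \<forall>r. eps r \<bullet> h > 0 \<longrightarrow> eps r \<bullet> a = f r"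
proof (intro exI allI impI)
  define a :: "real^'n" where "a = (\<chi> j. if h $ j > 0 then f (Inl j) else - f (Inr j))"
  show "eps r \<bullet> a = f r" if "eps r \<bullet> h > 0" for r
    using that by (cases r) (auto simp: a_def inner_axis')
qed

lemma card_positive_half:
  fixes h :: "real^'n::finite"
  assumes h: "\<And>r :: 'n + 'n. eps r \<bullet> h \<noteq> 0"
  shows "card {r. eps r \<bullet> h > 0} = CARD('n)"
proof -
  let ?f = "\<lambda>j. if h $ j > 0 then Inl j else Inr j :: 'n + 'n"
  have nz: "h $ j \<noteq> 0" for j
    using h[of "Inl j"] by (simp add: inner_axis')
  have "{r. eps r \<bullet> h > 0} = range ?f"
  proof (intro set_eqI)
    fix r :: "'n + 'n"
    show "r \<in> {r. eps r \<bullet> h > 0} \<longleftrightarrow> r \<in> range ?f"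
      using nz by (cases r) (auto simp: inner_axis' image_iff not_less order.order_iff_strict)
  qed
  moreover have "inj ?f"
    by (rule injI) (auto split: if_splits)
  ultimately show ?thesis
    by (simp only: card_image)
qed

text \<open>Weights and integer lists are compared inside the lists of reals: the former enter by
  their coordinates along \<open>rs\<close>, the latter by multiplication by \<open>m'\<close>. Both
  maps are injective, and their images agree.\<close>

lemma N_C_eq_card_lists:
  fixes P :: "(real^'n::finite) set"
  assumes P: "positive_system sp_roots P"
    and p: "prime p" and m: "m = p ^ i * m'" "m > 0" and m': "\<not> p dvd m'"
  shows "N_C P m p = card {b::int list. length b = CARD('n) \<and>
    sorted_wrt (>) ([int p ^ i] @ b @ [0]) \<and> (\<forall>x\<in>set b. step p dvd x)}"
    (is "_ = card ?L")
proof -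
  obtain h where h: "\<forall>\<alpha>\<in>sp_roots. \<alpha> \<bullet> h \<noteq> 0" and Ph: "P = {\<alpha>\<in>sp_roots. \<alpha> \<bullet> h > 0}"
    using P unfolding positive_system_def by blast
  have inj_h: "inj (\<lambda>r :: 'n + 'n. eps r \<bullet> h)"
  proof (rule injI, rule ccontr)
    fix r c :: "'n + 'n"
    assume "eps r \<bullet> h = eps c \<bullet> h" "r \<noteq> c"
    then have "eps r - eps c \<in> sp_roots" "(eps r - eps c) \<bullet> h = 0"
      by (auto simp: sp_roots_eq inner_diff_left)
    then show False using h by blast
  qed
  have nz: "eps r \<bullet> h \<noteq> 0" for r :: "'n + 'n"
    using injD[OF inj_h, of r "flip r"] by auto
  obtain rs :: "('n + 'n) list" where rs: "distinct rs" "set rs = {r. eps r \<bullet> h > 0}"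
    "sorted_wrt (\<lambda>r c. eps r \<bullet> h > eps c \<bullet> h) rs"
    using obtain_decreasing_enumeration[of "{r. eps r \<bullet> h > 0}" "\<lambda>r. eps r \<bullet> h"]
      inj_on_subset[OF inj_h] by auto
  have len: "length rs = CARD('n)"
    using distinct_card[OF rs(1)] by (simp add: rs(2) card_positive_half[OF nz])
  have m'0: "m' > 0" using m by (cases m') auto
  define mult :: "real \<Rightarrow> bool" where "mult x \<longleftrightarrow> (\<exists>z. x = of_int (int m' * (step p * z)))" for x
  \<comment> \<open>Invariance under negation allows the condition to be tested on
    \<open>rs\<close>, whatever signs \<open>h\<close> prescribes.\<close>
  have mult_minus: "mult (- x) \<longleftrightarrow> mult x" for x
  proof -
    have "mult (- x)" if "mult x" for x
      using that unfolding mult_def by (metis mult_minus_right of_int_minus)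
    from this[of x] this[of "- x"] show ?thesis by auto
  qed
  define A where "A = {a :: real^'n. sorted_wrt (>) ([real m] @ map (\<lambda>r. eps r \<bullet> a) rs @ [0]) \<and>
      (\<forall>r\<in>set rs. mult (eps r \<bullet> a))}"
  have all_mult: "(\<forall>r\<in>set rs. mult (eps r \<bullet> a)) \<longleftrightarrow> (\<forall>j. mult (a $ j))" for a :: "real^'n"
  proof
    assume *: "\<forall>r\<in>set rs. mult (eps r \<bullet> a)"
    show "\<forall>j. mult (a $ j)"
    proof
      fix j
      have "Inl j \<in> set rs \<or> Inr j \<in> set rs"
        using nz[of "Inl j"] by (auto simp: rs(2))
      then show "mult (a $ j)"
        using * mult_minus by (force simp: inner_axis')
    qed
  qed (auto simp: eps_inner_eq mult_minus split: sum.split)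
  have "N_C P m p = card A"
  proof -
    let ?O = "\<lambda>a :: real^'n. (\<forall>r c. eps r \<bullet> h > eps c \<bullet> h \<longrightarrow> eps r \<bullet> a > eps c \<bullet> a) \<and>
        (\<forall>r. eps r \<bullet> a < real m)"
    let ?D = "\<lambda>a :: real^'n. \<forall>w\<in>weight_lattice sp_torus. denom_power p (w \<bullet> a / 2 / real m)"
    have iff: "a \<in> regular_weights (weight_lattice sp_torus) sp_roots (weyl_group Sp sp_torus) P m \<and> ?D a \<longleftrightarrow>
        a \<in> A" for a
    proof -
      have "(\<forall>j. a $ j \<in> \<int>) \<and> ?D a \<longleftrightarrow> (\<forall>j. mult (a $ j))"
      proof
        assume *: "\<forall>j. mult (a $ j)"
        then have "\<forall>j. a $ j \<in> \<int>"
          unfolding mult_def by (metis Ints_of_int)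
        then show "(\<forall>j. a $ j \<in> \<int>) \<and> ?D a"
          using * denom_power_weights_iff[OF _ p m m', of a] unfolding mult_def by blast
      qed (use denom_power_weights_iff[OF _ p m m', of a] in \<open>unfold mult_def, blast\<close>)
      moreover have "?O a \<longleftrightarrow> sorted_wrt (>) ([real m] @ map (\<lambda>r. eps r \<bullet> a) rs @ [0])"
        by (rule alcove_iff_decreasing[OF nz _ rs(2,3)]) (use m(2) in simp)
      ultimately show ?thesis
        unfolding sp_regular_weights[OF h Ph] A_def mem_Collect_eq all_mult by argo
    qed
    show ?thesis
      unfolding N_C_def num_regular_weights_def sp_roots_def[symmetric] sp_basic_inner iff
      by (simp only: Collect_mem_eq)
  qed
  also have "card A = card ((\<lambda>a. map (\<lambda>r. eps r \<bullet> a) rs) ` A)"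
  proof (rule card_image[symmetric], rule inj_onI, rule eq_if_eps_inner_eq)
    fix a a' :: "real^'n" and r :: "'n + 'n"
    assume "map (\<lambda>r. eps r \<bullet> a) rs = map (\<lambda>r. eps r \<bullet> a') rs"
    then have *: "eps r \<bullet> a = eps r \<bullet> a'" if "r \<in> set rs" for r
      using that by simp
    show "eps r \<bullet> a = eps r \<bullet> a'"
      using *[of r] *[of "flip r"] nz[of r]
      by (cases "eps r \<bullet> h" "0 :: real" rule: linorder_cases) (auto simp: rs(2))
  qed
  also have "(\<lambda>a. map (\<lambda>r. eps r \<bullet> a) rs) ` A = map (\<lambda>x. real_of_int (int m' * x)) ` ?L"
  proof -
    \<comment> \<open>With the bounds kept as list entries, multiplication by \<open>m'\<close>
      carries \<open>p ^ i\<close> to \<open>m\<close> and 0 to 0 along with the rest.\<close>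
    have scale: "sorted_wrt (>) ([real m] @ map (\<lambda>x. real_of_int (int m' * x)) b @ [0]) \<longleftrightarrow>
        sorted_wrt (>) ([int p ^ i] @ b @ [0])" for b
    proof -
      have gt: "real_of_int (int m' * x) > real_of_int (int m' * y) \<longleftrightarrow> x > y" for x y
        using m'0 by (simp only: of_int_less_iff mult_less_cancel_left_pos of_nat_0_less_iff)
      have "[real m] @ map (\<lambda>x. real_of_int (int m' * x)) b @ [0] =
          map (\<lambda>x. real_of_int (int m' * x)) ([int p ^ i] @ b @ [0])"
        by (simp add: m(1))
      then show ?thesis
        by (simp only: sorted_wrt_map gt)
    qed
    show ?thesis
    proof (intro equalityI subsetI)
      fix l
      assume "l \<in> (\<lambda>a. map (\<lambda>r. eps r \<bullet> a) rs) ` A"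
      then obtain a where a: "a \<in> A" and l: "l = map (\<lambda>r. eps r \<bullet> a) rs" by blast
      obtain z where z: "\<And>r. r \<in> set rs \<Longrightarrow> eps r \<bullet> a = of_int (int m' * (step p * z r))"
        using a unfolding A_def mult_def mem_Collect_eq by metis
      define b where "b = map (\<lambda>r. step p * z r) rs"
      have lb: "l = map (\<lambda>x. real_of_int (int m' * x)) b"
        by (simp add: l b_def z)
      have "sorted_wrt (>) ([real m] @ l @ [0])"
        using a unfolding A_def l by blast
      then have "sorted_wrt (>) ([int p ^ i] @ b @ [0])"
        unfolding lb scale .
      moreover have "length b = CARD('n)" "\<forall>x\<in>set b. step p dvd x"
        by (auto simp: b_def len)
      ultimately have "b \<in> ?L"
        by blast
      then show "l \<in> map (\<lambda>x. real_of_int (int m' * x)) ` ?L"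
        using lb by blast
    next
      fix l
      assume "l \<in> map (\<lambda>x. real_of_int (int m' * x)) ` ?L"
      then obtain b where b: "b \<in> ?L" and l: "l = map (\<lambda>x. real_of_int (int m' * x)) b" by blast
      have "length rs = length l"
        using b by (simp add: len l)
      \<comment> \<open>The prescribed value at the \<open>k\<close>-th index of \<open>rs\<close>
        is the \<open>k\<close>-th entry of \<open>l\<close>; this is unambiguous because
        \<open>rs\<close> is distinct.\<close>
      obtain a where a: "\<And>r. eps r \<bullet> h > 0 \<Longrightarrow> eps r \<bullet> a = the (map_of (zip rs l) r)"
        using weight_with_coordinates_exists[of h "\<lambda>r. the (map_of (zip rs l) r)"] by auto
      have la: "map (\<lambda>r. eps r \<bullet> a) rs = l"
      proof (rule nth_equalityI)
        fix k
        assume "k < length (map (\<lambda>r. eps r \<bullet> a) rs)"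
        then have k: "k < length rs" by simp
        then have "eps (rs ! k) \<bullet> h > 0"
          using nth_mem[of k rs] by (simp add: rs(2))
        then show "map (\<lambda>r. eps r \<bullet> a) rs ! k = l ! k"
          using k \<open>length rs = length l\<close> by (simp add: a map_of_zip_nth rs(1))
      qed (simp add: \<open>length rs = length l\<close>)
      have "mult x" if "x \<in> set l" for x
        using that b by (auto simp: l mult_def elim!: dvdE)
      then have "\<forall>r\<in>set rs. mult (eps r \<bullet> a)"
        by (auto simp flip: la)
      moreover have "sorted_wrt (>) ([real m] @ map (\<lambda>r. eps r \<bullet> a) rs @ [0])"
        using b unfolding la l scale by blast
      ultimately have "a \<in> A"
        by (simp add: A_def)
      then show "l \<in> (\<lambda>a. map (\<lambda>r. eps r \<bullet> a) rs) ` A"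
        using la by blast
    qed
  qed
  also have "card (map (\<lambda>x. real_of_int (int m' * x)) ` ?L) = card ?L"
  proof -
    have "inj (\<lambda>x. real_of_int (int m' * x))"
      using m'0 by (intro injI) simp
    then show ?thesis
      by (intro card_image inj_on_subset[OF inj_mapI subset_UNIV])
  qed
  finally show ?thesis .
qed

text \<open>The conjunct \<open>v < u\<close> matters when \<open>b\<close> is empty.\<close>

lemma sorted_between_iff:
  "sorted_wrt (>) ([u] @ b @ [v]) \<longleftrightarrow> sorted_wrt (>) b \<and> set b \<subseteq> {v<..<u} \<and> v < u"
  for u v :: "'a::linorder"
  by (auto simp: sorted_wrt_append)

theorem mainTheorem4:
  fixes P :: "(real^'n::finite) set" and m p i m' :: nat
  assumes "CARD('n) > 1"
    and "positive_system sp_roots P"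
    and "m > 0"
    and "prime p"
    and "m = p ^ i * m'" and "\<not> p dvd m'"
  shows "(p = 2 \<longrightarrow>
           N_C P m p = card {b::int list. length b = CARD('n) \<and>
             sorted_wrt (>) ([int p ^ i] @ b @ [0])} \<and>
           N_C P m p = (2 ^ i - 1) choose CARD('n)) \<and>
         (p > 2 \<longrightarrow>
           N_C P m p = card {b::int list. length b = CARD('n) \<and>
             sorted_wrt (>) ([int p ^ i] @ b @ [0]) \<and> (\<forall>x\<in>set b. 2 dvd x)} \<and>
           N_C P m p = ((p ^ i - 1) div 2) choose CARD('n))"
proof -
  let ?L = "{b::int list. length b = CARD('n) \<and> sorted_wrt (>) ([int p ^ i] @ b @ [0]) \<and>
      (\<forall>x\<in>set b. step p dvd x)}"
  define T where "T = {x. 0 < x \<and> x < int p ^ i \<and> step p dvd x}"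
  have N: "N_C P m p = card ?L"
    by (rule N_C_eq_card_lists) (use assms in auto)
  have "finite T"
    by (rule finite_subset[of _ "{0..int p ^ i}"]) (auto simp: T_def)
  have "int p ^ i > 0"
    using assms by (simp add: prime_gt_0_nat)
  then have "?L = {b. length b = CARD('n) \<and> sorted_wrt (>) b \<and> set b \<subseteq> T}"
    unfolding sorted_between_iff by (auto simp: T_def)
  then have N': "N_C P m p = card T choose CARD('n)"
    using N card_strictly_decreasing_lists[OF \<open>finite T\<close>] by simp
  show ?thesis
  proof (intro conjI impI)
    assume "p = 2"
    then have "T = {0<..<2 ^ i}"
      by (auto simp: T_def step_def)
    then have "card T = 2 ^ i - 1"
      by (simp add: nat_diff_distrib nat_power_eq)
    then show "N_C P m p = (2 ^ i - 1) choose CARD('n)"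
      using N' by simp
    show "N_C P m p = card {b::int list. length b = CARD('n) \<and> sorted_wrt (>) ([int p ^ i] @ b @ [0])}"
      unfolding N using \<open>p = 2\<close> by (simp add: step_def)
  next
    assume "p > 2"
    show "N_C P m p = card {b::int list. length b = CARD('n) \<and>
        sorted_wrt (>) ([int p ^ i] @ b @ [0]) \<and> (\<forall>x\<in>set b. 2 dvd x)}"
      unfolding N using \<open>p > 2\<close> by (simp add: step_def)
    have "odd (p ^ i)"
      using \<open>p > 2\<close> assms(4) by (simp add: prime_odd_nat)
    then obtain t where t: "p ^ i = 2 * t + 1"
      by (elim oddE)
    then have ti: "int p ^ i = 2 * int t + 1"
      by (metis of_nat_1 of_nat_add of_nat_mult of_nat_numeral of_nat_power)
    \<comment> \<open>The even numbers strictly between 0 and \<open>2 * t + 1\<close> are 2, 4,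
      ..., \<open>2 * t\<close>; for \<open>i = 0\<close> there are none.\<close>
    have "T = (\<lambda>k. 2 * int k) ` {1..t}"
    proof (intro equalityI subsetI)
      fix x
      assume "x \<in> T"
      then obtain y where "x = 2 * y" "0 < y" "y \<le> int t"
        using \<open>p > 2\<close> by (auto simp: T_def step_def ti)
      then show "x \<in> (\<lambda>k. 2 * int k) ` {1..t}"
        by (intro image_eqI[of _ _ "nat y"]) auto
    qed (use \<open>p > 2\<close> in \<open>auto simp: T_def step_def ti\<close>)
    then have "card T = t"
      by (simp add: card_image inj_on_def)
    then show "N_C P m p = ((p ^ i - 1) div 2) choose CARD('n)"
      using N' t by simp
  qed
qed

end
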